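(* For a positive integer $n \equiv 0 \pmod 5$ and $k \ge 2$, let $F_1, F_2, \ldots, F_k$ be graphs on a common set of $n$ vertices, each of which is isomorphic to the vertex-disjoint union of $n/5$ copies of the $5$-cycle $C_5$. Then $\gamma_{\rm sd}(F_1,F_2) \le 3n/5$, and this bound is sharp (that is, there exist a positive integer $n \equiv 0 \pmod 5$ and two such graphs $F_1,F_2$ on $n$ vertices with $\gamma_{\rm sd}(F_1,F_2) = 3n/5$). Further, for $k \ge 3$, \[ \gamma_{\rm sd}(F_1,F_2,\ldots,F_k) \le \left( \frac{3}{5} + \frac{2}{5} \left( 1 - \left( \frac{3}{5} \right)^{k-2} \right) \right) n. \]
   Context: All graphs are finite and simple. Given graphs $F_1,\ldots,F_k$ (called factors; not necessarily edge-disjoint) with common vertex set $V$, a set $S \subseteq V$ is a simultaneous dominating set if for every $i$, $1 \le i \le k$, every vertex not in $S$ is adjacent in $F_i$ to some vertex of $S$. The simultaneous domination number $\gamma_{\rm sd}(F_1,\ldots,F_k)$ is the minimum cardinality of a simultaneous dominating set. *)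

theory Defs
  imports Complex_Main "Graph_Theory.Graph_Theory"
begin

text \<open>
  A finite simple graph is a \<^locale>\<open>pair_graph\<close>: a finite, loop-free digraph whose arcs are ordered
  pairs and form a symmetric relation. Adjacency of \<open>u\<close> and \<open>v\<close> in \<open>G\<close> is \<open>u \<rightarrow>\<^bsub>G\<^esub> v\<close>.
\<close>

definition simultaneous_dominating_set ::
    "'a set \<Rightarrow> 'i set \<Rightarrow> ('i \<Rightarrow> 'a pair_pre_digraph) \<Rightarrow> 'a set \<Rightarrow> bool" where
  "simultaneous_dominating_set V I F S \<longleftrightarrow>
     S \<subseteq> V \<and> (\<forall>i\<in>I. \<forall>v\<in>V - S. \<exists>u\<in>S. v \<rightarrow>\<^bsub>with_proj (F i)\<^esub> u)"

text \<open>
  For finite \<open>V\<close> the minimum ranges over a finite set, which is nonempty because \<open>V\<close> itself is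
  simultaneously dominating.
\<close>

definition gamma_sd :: "'a set \<Rightarrow> 'i set \<Rightarrow> ('i \<Rightarrow> 'a pair_pre_digraph) \<Rightarrow> nat" where
  "gamma_sd V I F = Min (card ` {S. simultaneous_dominating_set V I F S})"

text \<open>The following is the cycle of length \<open>n\<close> only for \<open>n \<ge> 3\<close>.\<close>

definition cycle_graph :: "nat \<Rightarrow> nat pair_pre_digraph" where
  "cycle_graph n =
     \<lparr> pverts = {..<n},
       parcs = {(u, v). u < n \<and> v < n \<and> (v = Suc u mod n \<or> u = Suc v mod n)} \<rparr>"

definition disjoint_copies :: "nat \<Rightarrow> 'a pair_pre_digraph \<Rightarrow> (nat \<times> 'a) pair_pre_digraph" where
  "disjoint_copies m G =
     \<lparr> pverts = {..<m} \<times> pverts G,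
       parcs = {((i, u), (i, v)) | i u v. i < m \<and> (u, v) \<in> parcs G} \<rparr>"

definition C5_factor :: "'a set \<Rightarrow> 'a pair_pre_digraph \<Rightarrow> bool" where
  "C5_factor V F \<longleftrightarrow> pair_graph F \<and> pverts F = V \<and>
     digraph_iso (with_proj F) (with_proj (disjoint_copies (card V div 5) (cycle_graph 5)))"

lemma pair_graph_cycle_graph:
  assumes "n \<ge> 3"
  shows "pair_graph (cycle_graph n)"
proof
  show "finite (parcs (cycle_graph n))"
    by (rule finite_subset[of _ "{..<n} \<times> {..<n}"]) (auto simp: cycle_graph_def)
qed (use assms in \<open>auto simp: cycle_graph_def symmetric_def sym_def mod_Suc split: if_splits\<close>)

lemma pair_graph_disjoint_copies:
  assumes "pair_graph G"
  shows "pair_graph (disjoint_copies m G)"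
proof -
  interpret pair_graph G by fact
  show ?thesis
  proof
    show "finite (parcs (disjoint_copies m G))"
      by (rule finite_subset[of _ "({..<m} \<times> pverts G) \<times> ({..<m} \<times> pverts G)"])
        (auto simp: disjoint_copies_def in_arcsD1 in_arcsD2)
  qed (use pair_no_loops pair_sym_arcs in
      \<open>auto simp: disjoint_copies_def symmetric_def sym_def in_arcsD1 in_arcsD2\<close>)
qed

end

theory Submission
  imports Defs
begin

text \<open>
  Pass to complements: \<open>V - T\<close> is simultaneously dominating iff every vertex of \<open>T\<close> has, in every
  factor, a neighbour outside \<open>T\<close>, and this property is inherited by subsets of \<open>T\<close>.

  For two factors, view each vertex as an edge joining the 5-cycle of \<open>F\<^sub>1\<close> and the 5-cycle of \<open>F\<^sub>2\<close>
  that contain it. This bipartite multigraph is 5-regular, so by Hall's theorem it has two disjoint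
  perfect matchings. Their union \<open>T\<close> has \<open>2n/5\<close> elements and meets each 5-cycle in two vertices, so no
  vertex of \<open>T\<close> has both its neighbours on the cycle in \<open>T\<close>. Each further factor costs at most two
  fifths of \<open>T\<close>, because a set of vertices of a 5-cycle can be thinned out to at least three fifths of
  it so that no remaining vertex has both neighbours remaining. Sharpness: the 5-cycle and its
  complement.
\<close>

section \<open>Hall's marriage theorem\<close>

text \<open>
  Rado's proof: if deleting \<open>(i, x)\<close> and deleting \<open>(i, y)\<close> both violate Hall's condition, then adding the
  violations of the two index sets \<open>J\<close> and \<open>K\<close> contradicts the condition for \<open>J \<union> K\<close> and
  \<open>J \<inter> K - {i}\<close>.
\<close>

lemma hall_marriage:
  assumes "finite I" "finite R" and "\<And>J. J \<subseteq> I \<Longrightarrow> card J \<le> card (R `` J)"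
  shows "\<exists>h. inj_on h I \<and> (\<forall>i\<in>I. (i, h i) \<in> R)"
  using assms(2,3)
proof (induction R rule: measure_induct_rule[where f = card])
  case (less R)
  have fin: "finite (R' `` J)" if "R' \<subseteq> R" for R' J
    using less.prems(1) that by (meson finite_Image finite_subset)
  show ?case
  proof (cases "\<exists>i\<in>I. \<exists>x y. (i, x) \<in> R \<and> (i, y) \<in> R \<and> x \<noteq> y")
    case True
    then obtain i x y where i: "i \<in> I" and x: "(i, x) \<in> R" and y: "(i, y) \<in> R" and "x \<noteq> y"
      by blast
    have violated: "\<exists>J\<subseteq>I. i \<in> J \<and> card ((R - {(i, z)}) `` J) < card J"
      if z: "(i, z) \<in> R" and no: "\<nexists>h. inj_on h I \<and> (\<forall>j\<in>I. (j, h j) \<in> R - {(i, z)})" for z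
    proof -
      have "card (R - {(i, z)}) < card R"
        using z less.prems(1) by (rule card_Diff1_less[rotated])
      then obtain J where J: "J \<subseteq> I" "\<not> card J \<le> card ((R - {(i, z)}) `` J)"
        using less.IH[of "R - {(i, z)}"] less.prems(1) no by blast
      \<comment> \<open>Away from \<open>i\<close> the deletion changes nothing, so a violating set
        without \<open>i\<close> would also violate Hall's condition for \<open>R\<close>.\<close>
      have "i \<in> J"
      proof (rule ccontr)
        assume "i \<notin> J"
        then have "(R - {(i, z)}) `` J = R `` J" by blast
        with J less.prems(2) show False by simp
      qed
      with J show ?thesis by (auto simp: not_le)
    qed
    show ?thesis
    proof (rule ccontr)
      assume no: "\<nexists>h. inj_on h I \<and> (\<forall>i\<in>I. (i, h i) \<in> R)"
      obtain J where J: "J \<subseteq> I" "i \<in> J" "card ((R - {(i, x)}) `` J) < card J"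
        using violated[OF x] no by blast
      obtain K where K: "K \<subseteq> I" "i \<in> K" "card ((R - {(i, y)}) `` K) < card K"
        using violated[OF y] no by blast
      define P where "P = (R - {(i, x)}) `` J"
      define Q where "Q = (R - {(i, y)}) `` K"
      have finPQ: "finite P" "finite Q" by (auto simp: P_def Q_def intro: fin)
      have finJK: "finite J" "finite K" using J K assms(1) finite_subset by blast+
      \<comment> \<open>As \<open>i\<close> lies in both \<open>J\<close> and \<open>K\<close>, the
        pair lost in one deletion survives in the other.\<close>
      have "R `` (J \<union> K) \<subseteq> P \<union> Q"
        using J(2) K(2) \<open>x \<noteq> y\<close> by (auto simp: P_def Q_def)
      then have "card (J \<union> K) \<le> card (P \<union> Q)"
        using less.prems(2)[of "J \<union> K"] J K card_mono[of "P \<union> Q"] finPQ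
        by (meson Un_least finite_UnI order_trans)
      moreover have "R `` (J \<inter> K - {i}) \<subseteq> P \<inter> Q" by (auto simp: P_def Q_def)
      then have "card (J \<inter> K - {i}) \<le> card (P \<inter> Q)"
        using less.prems(2)[of "J \<inter> K - {i}"] J card_mono[of "P \<inter> Q"] finPQ
        by (meson Diff_subset finite_Int inf.coboundedI1 order_trans)
      moreover have "card (J \<inter> K - {i}) + 1 = card (J \<inter> K)"
        using card_Suc_Diff1[of "J \<inter> K" i] finJK J(2) K(2) by simp
      moreover have "card (P \<union> Q) + card (P \<inter> Q) = card P + card Q"
        using card_Un_Int[OF finPQ] by simp
      moreover have "card (J \<union> K) + card (J \<inter> K) = card J + card K"
        using card_Un_Int[OF finJK] by simp
      \<comment> \<open>Hall's condition bounds \<open>card P + card Q\<close> below by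
        \<open>card J + card K - 1\<close>, the violations bound it above by
        \<open>card J + card K - 2\<close>.\<close>
      ultimately show False using J(3) K(3) by (simp add: P_def Q_def)
    qed
  next
    \<comment> \<open>No index has two partners left. Hall's condition for singletons gives each
      index a partner, and for pairs it keeps the partners distinct.\<close>
    case False
    have "\<exists>x. (i, x) \<in> R" if "i \<in> I" for i
    proof (rule ccontr)
      assume "\<nexists>x. (i, x) \<in> R"
      then have "R `` {i} = {}" by blast
      with less.prems(2)[of "{i}"] that show False by simp
    qed
    then obtain h where h: "\<And>i. i \<in> I \<Longrightarrow> (i, h i) \<in> R" by metis
    have "inj_on h I"
    proof (rule inj_onI, rule ccontr)
      fix i j assume ij: "i \<in> I" "j \<in> I" "h i = h j" "i \<noteq> j"
      have "R `` {k} \<subseteq> {h i}" if "k \<in> {i, j}" for k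
        using False h[of k] that ij by auto
      then have "R `` {i, j} \<subseteq> {h i}" by blast
      then have "card (R `` {i, j}) \<le> 1" using card_mono[of "{h i}"] by fastforce
      with less.prems(2)[of "{i, j}"] ij show False by simp
    qed
    with h show ?thesis by blast
  qed
qed

section \<open>Perfect matchings in regular bipartite multigraphs\<close>

lemma card_eq_mult_card_image:
  assumes "finite V" "\<And>v. v \<in> V \<Longrightarrow> card {w \<in> V. f w = f v} = r"
  shows "card V = r * card (f ` V)"
proof -
  have "card V = (\<Sum>a\<in>f ` V. card {w \<in> V. f w = a})"
    using sum.image_gen[OF assms(1), of "\<lambda>_. 1 :: nat" f] by simp
  also have "\<dots> = (\<Sum>a\<in>f ` V. r)"
    using assms(2) by (intro sum.cong) auto
  finally show ?thesis by simp
qed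

text \<open>
  The elements of \<open>V\<close> are the edges of a bipartite multigraph, where \<open>v\<close> joins \<open>f v\<close> to \<open>g v\<close>.
\<close>

lemma regular_bipartite_perfect_matching:
  assumes fin: "finite V" and r: "r > 0"
    and f: "\<And>v. v \<in> V \<Longrightarrow> card {w \<in> V. f w = f v} = r"
    and g: "\<And>v. v \<in> V \<Longrightarrow> card {w \<in> V. g w = g v} = r"
  shows "\<exists>M\<subseteq>V. inj_on f M \<and> inj_on g M \<and> f ` M = f ` V \<and> g ` M = g ` V"
proof -
  define R where "R = (\<lambda>v. (f v, g v)) ` V"
  have "\<exists>h. inj_on h (f ` V) \<and> (\<forall>i\<in>f ` V. (i, h i) \<in> R)"
  proof (rule hall_marriage)
    fix J assume J: "J \<subseteq> f ` V"
    \<comment> \<open>Double counting: the edges \<open>U\<close> that leave \<open>J\<close> are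
      among the edges \<open>W\<close> that end at a neighbour of \<open>J\<close>, and by
      regularity each set has \<open>r\<close> times as many edges as ends on its side.\<close>
    define U where "U = {v \<in> V. f v \<in> J}"
    define W where "W = {v \<in> V. g v \<in> R `` J}"
    have "card U = r * card (f ` U)"
      using fin f by (intro card_eq_mult_card_image) (auto simp: U_def intro!: arg_cong[where f=card] trans[OF _ f])
    moreover have "f ` U = J" using J by (auto simp: U_def)
    moreover have "card W = r * card (g ` W)"
      using fin g by (intro card_eq_mult_card_image) (auto simp: W_def intro!: arg_cong[where f=card] trans[OF _ g])
    moreover have "g ` W = R `` J" by (auto simp: W_def R_def)
    moreover have "card U \<le> card W"
      using fin by (intro card_mono) (auto simp: U_def W_def R_def)
    ultimately show "card J \<le> card (R `` J)" using r by simp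
  qed (use fin in \<open>auto simp: R_def\<close>)
  then obtain h where h: "inj_on h (f ` V)" "\<And>i. i \<in> f ` V \<Longrightarrow> (i, h i) \<in> R" by blast
  \<comment> \<open>\<open>R\<close> forgets parallel edges; one edge is selected for each matched
    pair.\<close>
  have "\<exists>v. v \<in> V \<and> f v = i \<and> g v = h i" if "i \<in> f ` V" for i
    using h(2)[OF that] by (auto simp: R_def)
  then obtain e where e: "\<And>i. i \<in> f ` V \<Longrightarrow> e i \<in> V \<and> f (e i) = i \<and> g (e i) = h i" by metis
  define M where "M = e ` f ` V"
  have "M \<subseteq> V" using e by (auto simp: M_def)
  have "f ` M = (\<lambda>i. f (e i)) ` f ` V" by (simp add: M_def image_image)
  also have "\<dots> = (\<lambda>i. i) ` f ` V" using e by (intro image_cong) auto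
  finally have fM: "f ` M = f ` V" by simp
  have "inj_on f M" using e by (auto simp: M_def inj_on_def)
  have "inj_on g M"
  proof (rule inj_onI)
    fix v w assume "v \<in> M" "w \<in> M" "g v = g w"
    then obtain i j where ij: "i \<in> f ` V" "j \<in> f ` V" "v = e i" "w = e j" by (auto simp: M_def)
    have "h i = h j" using e[OF ij(1)] e[OF ij(2)] \<open>g v = g w\<close> ij(3,4) by simp
    then have "i = j" using inj_onD[OF h(1)] ij(1,2) by blast
    then show "v = w" using ij(3,4) by simp
  qed
  \<comment> \<open>By regularity both sides have equally many classes, so \<open>g\<close>, being
    injective on \<open>M\<close>, reaches every class on its side.\<close>
  have "card (g ` M) = card (f ` V)"
    using \<open>inj_on f M\<close> \<open>inj_on g M\<close> fM by (metis card_image)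
  also have "\<dots> = card (g ` V)"
    using card_eq_mult_card_image[OF fin f] card_eq_mult_card_image[OF fin g] r by simp
  finally have "g ` M = g ` V"
    using \<open>M \<subseteq> V\<close> fin by (intro card_subset_eq) auto
  with \<open>M \<subseteq> V\<close> fM \<open>inj_on f M\<close> \<open>inj_on g M\<close> show ?thesis by blast
qed

lemma card_fibre_inj_on:
  assumes "inj_on f M" "v \<in> f ` M"
  shows "card {w \<in> M. f w = v} = 1"
proof -
  obtain w where "w \<in> M" "f w = v" using assms(2) by blast
  then have "{w \<in> M. f w = v} = {w}" using assms(1) by (auto simp: inj_on_def)
  then show ?thesis by simp
qed

text \<open>Deleting a perfect matching lowers every degree by one, so the rest is regular again and
  can be matched once more.\<close>

lemma card_fibre_Diff:
  assumes "finite V" "M \<subseteq> V" "inj_on h M" "h ` M = h ` V" "v \<in> V"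
    and "card {w \<in> V. h w = h v} = r"
  shows "card {w \<in> V - M. h w = h v} = r - 1"
proof -
  have "card {w \<in> M. h w = h v} = 1"
    using assms by (intro card_fibre_inj_on) auto
  moreover have "{w \<in> V - M. h w = h v} = {w \<in> V. h w = h v} - {w \<in> M. h w = h v}" by blast
  moreover have "{w \<in> M. h w = h v} \<subseteq> {w \<in> V. h w = h v}" using assms(2) by blast
  ultimately show ?thesis
    using assms(1,2,6) by (simp add: card_Diff_subset finite_subset)
qed

lemma card_fibre_Un_le_2:
  assumes "inj_on h M" "inj_on h N"
  shows "card {w \<in> M \<union> N. h w = a} \<le> 2"
proof -
  have le1: "card {w \<in> K. h w = a} \<le> 1" if "inj_on h K" for K
  proof (cases "a \<in> h ` K")
    case True
    then show ?thesis using card_fibre_inj_on[OF that] by simp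
  next
    case False
    then have "{w \<in> K. h w = a} = {}" by blast
    then show ?thesis by (metis card.empty zero_le)
  qed
  have "{w \<in> M \<union> N. h w = a} = {w \<in> M. h w = a} \<union> {w \<in> N. h w = a}" by blast
  then show ?thesis
    using card_Un_le[of "{w \<in> M. h w = a}" "{w \<in> N. h w = a}"] le1[of M] le1[of N] assms by simp
qed

text \<open>A perfect matching \<open>M\<close> of all edges is followed by a perfect matching
  \<open>N\<close> of the \<open>(r - 1)\<close>-regular rest; \<open>r \<ge> 2\<close> makes that
  degree positive. Each matching contributes at most one edge at every class.\<close>

lemma regular_bipartite_two_factor:
  assumes fin: "finite V" and r: "r \<ge> 2"
    and f: "\<And>v. v \<in> V \<Longrightarrow> card {w \<in> V. f w = f v} = r"
    and g: "\<And>v. v \<in> V \<Longrightarrow> card {w \<in> V. g w = g v} = r"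
  shows "\<exists>T\<subseteq>V. r * card T = 2 * card V \<and>
    (\<forall>a. card {w \<in> T. f w = a} \<le> 2) \<and> (\<forall>b. card {w \<in> T. g w = b} \<le> 2)"
proof -
  obtain M where M: "M \<subseteq> V" "inj_on f M" "inj_on g M" "f ` M = f ` V" "g ` M = g ` V"
    using regular_bipartite_perfect_matching[OF fin _ f g] r by auto
  have f': "card {w \<in> V - M. f w = f v} = r - 1" if "v \<in> V - M" for v
    using that M fin f by (intro card_fibre_Diff) auto
  have g': "card {w \<in> V - M. g w = g v} = r - 1" if "v \<in> V - M" for v
    using that M fin g by (intro card_fibre_Diff) auto
  obtain N where N: "N \<subseteq> V - M" "inj_on f N" "inj_on g N" "f ` N = f ` (V - M)"
    using regular_bipartite_perfect_matching[OF _ _ f' g'] fin r by auto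
  have finMN: "finite M" "finite N" using M N fin by (auto intro: finite_subset)
  have "r * card M = card V"
    using card_eq_mult_card_image[OF fin f] card_image[OF M(2)] M(4) by simp
  moreover have "card (V - M) = (r - 1) * card N"
    using card_eq_mult_card_image[OF _ f'] fin card_image[OF N(2)] N(4) by simp
  then have "card V - card M = (r - 1) * card N"
    using M(1) finMN by (simp add: card_Diff_subset)
  moreover have "card (M \<union> N) = card M + card N"
    using N(1) finMN by (intro card_Un_disjoint) auto
  ultimately have "r * card (M \<union> N) = 2 * card V"
  proof -
    assume *: "r * card M = card V" "card V - card M = (r - 1) * card N"
      "card (M \<union> N) = card M + card N"
    \<comment> \<open>Since \<open>V\<close> has \<open>r * card M\<close> edges,
      \<open>V - M\<close> has \<open>(r - 1) * card M\<close>; hence both matchings have the same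
      size.\<close>
    have "(r - 1) * card M = (r - 1) * card N"
      using * by (simp add: algebra_simps flip: *(1))
    then have "card N = card M" using r by simp
    with * show ?thesis by (metis mult.left_commute mult_2)
  qed
  then show ?thesis
    using M N by (intro exI[of _ "M \<union> N"] conjI allI card_fibre_Un_le_2) auto
qed

section \<open>Sparse subsets of a single 5-cycle\<close>

text \<open>On the cycle of length 5, \<open>(a + 4) mod 5\<close> is the predecessor of \<open>a\<close>.\<close>

definition gapped :: "nat set \<Rightarrow> bool" where
  "gapped X \<longleftrightarrow> X \<subseteq> {..<5} \<and> (\<forall>a\<in>X. Suc a mod 5 \<notin> X \<or> (a + 4) mod 5 \<notin> X)"

lemma less_5_cases: "(a::nat) < 5 \<longleftrightarrow> a = 0 \<or> a = 1 \<or> a = 2 \<or> a = 3 \<or> a = 4"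
  by auto

text \<open>A violation consists of a vertex and its two neighbours, which are three distinct
  elements.\<close>

lemma gapped_if_card_le_2:
  assumes "X \<subseteq> {..<5}" "card X \<le> 2"
  shows "gapped X"
  unfolding gapped_def
proof (intro conjI ballI)
  fix a assume a: "a \<in> X"
  show "Suc a mod 5 \<notin> X \<or> (a + 4) mod 5 \<notin> X"
  proof (rule ccontr)
    assume "\<not> ?thesis"
    with a have "{a, Suc a mod 5, (a + 4) mod 5} \<subseteq> X" by blast
    moreover have "card {a, Suc a mod 5, (a + 4) mod 5} = 3"
      using a assms(1) by (auto simp: less_5_cases subset_iff)
    ultimately have "3 \<le> card X"
      using card_mono[of X] finite_subset[OF assms(1)] by (metis finite_lessThan)
    with assms(2) show False by simp
  qed
qed (fact assms(1))

text \<open>Sets of size at most 2 stay whole, size 3 is cut to 2, and sizes 4 and 5 are cut to 3.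
  The full cycle is the case that forces the ratio 3/5.\<close>

lemma ex_gapped_subset:
  assumes "X \<subseteq> {..<5}"
  shows "\<exists>Y\<subseteq>X. gapped Y \<and> 3 * card X \<le> 5 * card Y"
proof -
  have fin: "finite X" using assms finite_subset by blast
  have le: "card X \<le> 5" using card_mono[OF _ assms] by simp
  consider "card X \<le> 2" | "card X = 3" | "card X \<ge> 4" by linarith
  then show ?thesis
  proof cases
    case 1
    then show ?thesis using gapped_if_card_le_2[OF assms] by auto
  next
    case 2
    then obtain Y where "Y \<subseteq> X" "card Y = 2"
      using obtain_subset_with_card_n[of 2 X] by auto
    then show ?thesis using 2 gapped_if_card_le_2[of Y] assms by auto
  next
    case 3
    have "card ({..<5} - X) \<le> 1" using 3 assms fin by (simp add: card_Diff_subset)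
    then consider "{..<5} - X = {}" | j where "{..<5} - X = {j}"
      by (metis One_nat_def card_0_eq card_1_singletonE finite_Diff finite_lessThan le_Suc_eq le_zero_eq)
    \<comment> \<open>\<open>j\<close> is the vertex missing from \<open>X\<close>; if none is
      missing, 0 serves as well as any other.\<close>
    then obtain j where j: "{..<5} - X \<subseteq> {j}" "j < 5"
    proof cases
      case 1
      show ?thesis using that[of 0] unfolding 1 by simp
    next
      case (2 j)
      then show ?thesis using that[of j] by blast
    qed
    \<comment> \<open>Besides \<open>j\<close>, the vertex \<open>j + 3\<close> is dropped: what
      remains is the edge from \<open>j + 1\<close> to \<open>j + 2\<close> and the isolated vertex
      \<open>j + 4\<close>.\<close>
    define Y where "Y = {(j + 1) mod 5, (j + 2) mod 5, (j + 4) mod 5}"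
    have "Y \<subseteq> {..<5} - {j}" using j(2) by (auto simp: Y_def less_5_cases)
    then have "Y \<subseteq> X" using j(1) by blast
    moreover have "card Y = 3" using j(2) by (auto simp: Y_def less_5_cases)
    moreover have "gapped Y" using j(2) by (auto simp: Y_def gapped_def less_5_cases)
    ultimately show ?thesis using le by auto
  qed
qed

section \<open>Coordinates on a C5-factor\<close>

text \<open>The first coordinate numbers the 5-cycles, the second is the position on the
  cycle.\<close>

definition C5_coordinates :: "'a set \<Rightarrow> 'a pair_pre_digraph \<Rightarrow> ('a \<Rightarrow> nat \<times> nat) \<Rightarrow> bool" where
  "C5_coordinates V F \<phi> \<longleftrightarrow> bij_betw \<phi> V ({..<card V div 5} \<times> {..<5}) \<and>
     (\<forall>u\<in>V. \<forall>v\<in>V. (u, v) \<in> parcs F \<longleftrightarrow> fst (\<phi> u) = fst (\<phi> v) \<and>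
        (snd (\<phi> v) = Suc (snd (\<phi> u)) mod 5 \<or> snd (\<phi> u) = Suc (snd (\<phi> v)) mod 5))"

lemma parcs_disjoint_copies_cycle:
  "(x, y) \<in> parcs (disjoint_copies m (cycle_graph n)) \<longleftrightarrow>
     fst x = fst y \<and> fst x < m \<and> snd x < n \<and> snd y < n \<and>
     (snd y = Suc (snd x) mod n \<or> snd x = Suc (snd y) mod n)"
  by (cases x; cases y) (auto simp: disjoint_copies_def cycle_graph_def)

text \<open>A digraph isomorphism carries separate maps for vertices and arcs. Here arcs are pairs
  of vertices, so the vertex map alone determines adjacency.\<close>

lemma C5_factor_iff_coordinates:
  "C5_factor V F \<longleftrightarrow> pair_graph F \<and> pverts F = V \<and> (\<exists>\<phi>. C5_coordinates V F \<phi>)"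
proof -
  define m where "m = card V div 5"
  let ?D = "disjoint_copies m (cycle_graph 5)"
  have "digraph_iso (with_proj F) (with_proj ?D) \<longleftrightarrow> (\<exists>\<phi>. C5_coordinates V F \<phi>)"
    if "pair_graph F" and V: "pverts F = V"
  proof
    interpret pair_graph F by fact
    have inV: "u \<in> V" "v \<in> V" if "(u, v) \<in> parcs F" for u v
      using that V in_arcsD1 in_arcsD2 by auto
    {
      assume "digraph_iso (with_proj F) (with_proj ?D)"
      then obtain h where h: "digraph_isomorphism h" "with_proj ?D = app_iso h (with_proj F)"
        by (auto simp: digraph_iso_def)
      have "pverts ?D = verts (app_iso h (with_proj F))" by (simp flip: h(2))
      then have img: "iso_verts h ` V = {..<m} \<times> {..<5}"
        using V by (simp add: disjoint_copies_def cycle_graph_def)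
      have inj: "inj_on (iso_verts h) V"
        using digraph_isomorphism_inj_on_verts[OF h(1)] V by simp
      \<comment> \<open>\<open>arcs_ends\<close> describes arcs by their end points, which
        eliminates the arc map of \<open>h\<close>.\<close>
      have "parcs ?D = arcs_ends (app_iso h (with_proj F))" by (simp flip: h(2))
      also have "\<dots> = (\<lambda>(u, v). (iso_verts h u, iso_verts h v)) ` parcs F"
        using arcs_ends_app_iso_eq[OF h(1)] by simp
      finally have arcs: "parcs ?D = (\<lambda>(u, v). (iso_verts h u, iso_verts h v)) ` parcs F" .
      have arc: "(u, v) \<in> parcs F \<longleftrightarrow> (iso_verts h u, iso_verts h v) \<in> parcs ?D"
        if "u \<in> V" "v \<in> V" for u v
      proof
        assume "(u, v) \<in> parcs F"
        then show "(iso_verts h u, iso_verts h v) \<in> parcs ?D"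
          unfolding arcs by (rule rev_image_eqI) simp
      next
        assume "(iso_verts h u, iso_verts h v) \<in> parcs ?D"
        then obtain u' v' where "(u', v') \<in> parcs F" "iso_verts h u = iso_verts h u'"
          "iso_verts h v = iso_verts h v'"
          unfolding arcs by auto
        moreover from this have "u = u'" "v = v'" using inj_onD[OF inj] inV that by blast+
        ultimately show "(u, v) \<in> parcs F" by simp
      qed
      have rng: "fst (iso_verts h u) < m \<and> snd (iso_verts h u) < 5" if "u \<in> V" for u
        using imageI[OF that, of "iso_verts h"] img by auto
      have "C5_coordinates V F (iso_verts h)"
        using img inj arc rng
        by (simp add: C5_coordinates_def bij_betw_def parcs_disjoint_copies_cycle flip: m_def)
      then show "\<exists>\<phi>. C5_coordinates V F \<phi>" by blast
    next
      assume "\<exists>\<phi>. C5_coordinates V F \<phi>"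
      then obtain \<phi> where \<phi>: "C5_coordinates V F \<phi>" by blast
      then have inj: "inj_on \<phi> V" and img: "\<phi> ` V = {..<m} \<times> {..<5}"
        by (auto simp: C5_coordinates_def bij_betw_def m_def)
      \<comment> \<open>The arc map is forced: a pair goes to the pair of images, with
        \<open>fst\<close> and \<open>snd\<close> still giving tail and head.\<close>
      define h where "h = \<lparr>iso_verts = \<phi>, iso_arcs = map_prod \<phi> \<phi>, iso_head = snd, iso_tail = fst\<rparr>"
      have inj2: "inj_on (map_prod \<phi> \<phi>) (parcs F)"
        using map_prod_inj_on[OF inj inj] by (rule inj_on_subset) (auto dest: inV)
      have arc: "(u, v) \<in> parcs F \<longleftrightarrow> (\<phi> u, \<phi> v) \<in> parcs ?D" if "u \<in> V" "v \<in> V" for u v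
      proof -
        have rng: "fst (\<phi> w) < m \<and> snd (\<phi> w) < 5" if "w \<in> V" for w
          using imageI[OF that, of \<phi>] img by auto
        have "(u, v) \<in> parcs F \<longleftrightarrow> fst (\<phi> u) = fst (\<phi> v) \<and>
            (snd (\<phi> v) = Suc (snd (\<phi> u)) mod 5 \<or> snd (\<phi> u) = Suc (snd (\<phi> v)) mod 5)"
          using \<phi> that unfolding C5_coordinates_def by blast
        then show ?thesis
          using rng[OF that(1)] rng[OF that(2)] unfolding parcs_disjoint_copies_cycle by blast
      qed
      have "digraph_isomorphism h"
        using inj inj2 V wf_digraph_axioms
        by (auto simp: digraph_isomorphism_def h_def)
      moreover have "map_prod \<phi> \<phi> ` parcs F = parcs ?D"
      proof (intro equalityI subsetI)
        fix e assume "e \<in> map_prod \<phi> \<phi> ` parcs F"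
        then obtain u v where "(u, v) \<in> parcs F" "e = (\<phi> u, \<phi> v)" by auto
        then show "e \<in> parcs ?D" using arc[OF inV] by blast
      next
        fix e assume e: "e \<in> parcs ?D"
        obtain x y where xy: "e = (x, y)" by (cases e)
        then have "x \<in> {..<m} \<times> {..<5}" "y \<in> {..<m} \<times> {..<5}"
          using e by (auto simp: disjoint_copies_def cycle_graph_def)
        then obtain u v where "u \<in> V" "v \<in> V" "x = \<phi> u" "y = \<phi> v"
          using img by (metis imageE)
        then have "(u, v) \<in> parcs F" using arc e xy by blast
        then have "map_prod \<phi> \<phi> (u, v) \<in> map_prod \<phi> \<phi> ` parcs F" by (rule imageI)
        then show "e \<in> map_prod \<phi> \<phi> ` parcs F"
          unfolding xy \<open>x = \<phi> u\<close> \<open>y = \<phi> v\<close> by simp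
      qed
      then have "with_proj ?D = app_iso h (with_proj F)"
        using img V by (auto simp: app_iso_def h_def with_proj_def disjoint_copies_def cycle_graph_def)
      ultimately show "digraph_iso (with_proj F) (with_proj ?D)"
        unfolding digraph_iso_def by blast
    }
  qed
  then show ?thesis by (auto simp: C5_factor_def m_def)
qed

section \<open>Complements of dominating sets\<close>

definition codominated :: "'a set \<Rightarrow> 'a pair_pre_digraph \<Rightarrow> 'a set \<Rightarrow> bool" where
  "codominated V F T \<longleftrightarrow> T \<subseteq> V \<and> (\<forall>v\<in>T. \<exists>u\<in>V - T. (v, u) \<in> parcs F)"

lemma codominated_subset: "codominated V F T \<Longrightarrow> T' \<subseteq> T \<Longrightarrow> codominated V F T'"
  unfolding codominated_def by blast

lemma simultaneous_dominating_set_Diff: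
  "T \<subseteq> V \<Longrightarrow>
    simultaneous_dominating_set V I F (V - T) \<longleftrightarrow> (\<forall>i\<in>I. codominated V (F i) T)"
  by (auto simp: simultaneous_dominating_set_def codominated_def double_diff)

lemma C5_coordinates_row_subset:
  assumes "C5_coordinates V F \<phi>" "S \<subseteq> V"
  shows "{a. (i, a) \<in> \<phi> ` S} \<subseteq> {..<5}"
  using assms by (auto simp: C5_coordinates_def bij_betw_def)

lemma C5_coordinates_row_card:
  assumes "finite V" "C5_coordinates V F \<phi>" "S \<subseteq> V"
  shows "card S = (\<Sum>i<card V div 5. card {a. (i, a) \<in> \<phi> ` S})"
proof -
  have bij: "bij_betw \<phi> V ({..<card V div 5} \<times> {..<5})"
    using assms(2) by (simp add: C5_coordinates_def)
  have "card S = card (\<phi> ` S)"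
    using bij assms(3) by (metis bij_betw_def card_image inj_on_subset)
  also have "\<phi> ` S = (SIGMA i:{..<card V div 5}. {a. (i, a) \<in> \<phi> ` S})"
    using bij assms(3) by (auto simp: bij_betw_def)
  also have "card \<dots> = (\<Sum>i<card V div 5. card {a. (i, a) \<in> \<phi> ` S})"
    using finite_subset[OF C5_coordinates_row_subset[OF assms(2,3)]] by (intro card_SigmaI) auto
  finally show ?thesis .
qed

text \<open>A neighbouring position that \<open>T\<close> leaves free belongs, by surjectivity of
  \<open>\<phi>\<close>, to a vertex of \<open>V\<close> outside \<open>T\<close> on the same
  cycle.\<close>

lemma codominated_if_gapped:
  assumes \<phi>: "C5_coordinates V F \<phi>" and T: "T \<subseteq> V"
    and gapped: "\<And>i. gapped {a. (i, a) \<in> \<phi> ` T}"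
  shows "codominated V F T"
  unfolding codominated_def
proof (intro conjI ballI)
  fix v assume v: "v \<in> T"
  obtain i a where ia: "\<phi> v = (i, a)" by fastforce
  have bij: "bij_betw \<phi> V ({..<card V div 5} \<times> {..<5})"
    using \<phi> by (simp add: C5_coordinates_def)
  then have i: "i < card V div 5" and a: "a < 5"
    using bij_betwE[OF bij, rule_format, of v] ia v T by auto
  have "a \<in> {a. (i, a) \<in> \<phi> ` T}" using ia v by force
  with gapped[of i, unfolded gapped_def]
  have "Suc a mod 5 \<notin> {a. (i, a) \<in> \<phi> ` T} \<or> (a + 4) mod 5 \<notin> {a. (i, a) \<in> \<phi> ` T}"
    by (elim conjE) (rule bspec)
  then obtain b where b: "b \<in> {Suc a mod 5, (a + 4) mod 5}" "(i, b) \<notin> \<phi> ` T"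
    by (metis insertCI mem_Collect_eq)
  then have "(i, b) \<in> {..<card V div 5} \<times> {..<5}" using i by auto
  then obtain u where u: "u \<in> V" "\<phi> u = (i, b)" using bij by (metis bij_betw_iff_bijections)
  \<comment> \<open>For the predecessor \<open>b = (a + 4) mod 5\<close>, adjacency is the successor
    relation read from \<open>b\<close> to \<open>a\<close>.\<close>
  have "b = Suc a mod 5 \<or> a = Suc b mod 5" using b(1) a by (auto simp: less_5_cases)
  then have "(v, u) \<in> parcs F" using \<phi> u ia v T by (auto simp: C5_coordinates_def)
  moreover have "u \<notin> T" using u b(2) by force
  ultimately show "\<exists>u\<in>V - T. (v, u) \<in> parcs F" using u by blast
qed (fact T)

text \<open>Each 5-cycle is thinned out on its own by \<open>ex_gapped_subset\<close>; the
  inequalities are then added over all cycles.\<close>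

lemma ex_codominated_subset:
  assumes fin: "finite V" and \<phi>: "C5_coordinates V F \<phi>" and T: "T \<subseteq> V"
  shows "\<exists>T'\<subseteq>T. codominated V F T' \<and> 3 * card T \<le> 5 * card T'"
proof -
  define X where "X i = {a. (i, a) \<in> \<phi> ` T}" for i
  have "\<exists>Y\<subseteq>X i. gapped Y \<and> 3 * card (X i) \<le> 5 * card Y" for i
    unfolding X_def by (intro ex_gapped_subset C5_coordinates_row_subset[OF \<phi> T])
  then obtain Y where Y: "\<And>i. Y i \<subseteq> X i" "\<And>i. gapped (Y i)"
    "\<And>i. 3 * card (X i) \<le> 5 * card (Y i)"
    by metis
  define T' where "T' = {v \<in> T. snd (\<phi> v) \<in> Y (fst (\<phi> v))}"
  have "T' \<subseteq> T" by (auto simp: T'_def)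
  have row: "{a. (i, a) \<in> \<phi> ` T'} = Y i" for i
  proof
    show "{a. (i, a) \<in> \<phi> ` T'} \<subseteq> Y i"
      by (auto simp: T'_def) (metis fst_conv snd_conv)
    show "Y i \<subseteq> {a. (i, a) \<in> \<phi> ` T'}"
    proof
      fix a assume a: "a \<in> Y i"
      then obtain v where v: "v \<in> T" "(i, a) = \<phi> v" using Y(1)[of i] by (auto simp: X_def)
      with a have "v \<in> T'" by (simp add: T'_def flip: v(2))
      with v show "a \<in> {a. (i, a) \<in> \<phi> ` T'}" by blast
    qed
  qed
  have "codominated V F T'"
    using codominated_if_gapped[OF \<phi>] \<open>T' \<subseteq> T\<close> T Y(2) row by auto
  moreover have "3 * card T \<le> 5 * card T'"
  proof -
    have "3 * card T = (\<Sum>i<card V div 5. 3 * card (X i))"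
      using C5_coordinates_row_card[OF fin \<phi> T] by (simp add: X_def sum_distrib_left)
    also have "\<dots> \<le> (\<Sum>i<card V div 5. 5 * card (Y i))" by (intro sum_mono Y(3))
    also have "\<dots> = 5 * card T'"
      using C5_coordinates_row_card[OF fin \<phi>, of T'] \<open>T' \<subseteq> T\<close> T by (simp add: row sum_distrib_left)
    finally show ?thesis .
  qed
  ultimately show ?thesis using \<open>T' \<subseteq> T\<close> by blast
qed

text \<open>Supplies the 5-regularity of the multigraph whose two sides are the cycles of two
  factors.\<close>

lemma C5_coordinates_fibre_card:
  assumes "C5_coordinates V F \<phi>" "v \<in> V"
  shows "card {w \<in> V. fst (\<phi> w) = fst (\<phi> v)} = 5"
proof -
  have bij: "bij_betw \<phi> V ({..<card V div 5} \<times> {..<5})"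
    using assms(1) by (simp add: C5_coordinates_def)
  then have "fst (\<phi> v) < card V div 5" using bij_betwE[OF bij] assms(2) by auto
  moreover have "\<phi> ` {w \<in> V. fst (\<phi> w) = i} = {x \<in> \<phi> ` V. fst x = i}" for i by blast
  ultimately have "\<phi> ` {w \<in> V. fst (\<phi> w) = fst (\<phi> v)} = {fst (\<phi> v)} \<times> {..<5}"
    using bij by (auto simp: bij_betw_def)
  moreover have "inj_on \<phi> {w \<in> V. fst (\<phi> w) = fst (\<phi> v)}"
    using bij by (auto simp: bij_betw_def intro: inj_on_subset)
  ultimately show ?thesis using card_image by fastforce
qed

lemma codominated_if_fibres_le_2:
  assumes fin: "finite V" and \<phi>: "C5_coordinates V F \<phi>" and T: "T \<subseteq> V"
    and le: "\<And>i. card {w \<in> T. fst (\<phi> w) = i} \<le> 2"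
  shows "codominated V F T"
proof (rule codominated_if_gapped[OF \<phi> T])
  fix i
  have "{a. (i, a) \<in> \<phi> ` T} = (\<lambda>w. snd (\<phi> w)) ` {w \<in> T. fst (\<phi> w) = i}"
    by (auto simp: image_iff prod_eq_iff)
  also have "card \<dots> \<le> card {w \<in> T. fst (\<phi> w) = i}"
    using fin T by (intro card_image_le) (auto intro: finite_subset)
  finally have "card {a. (i, a) \<in> \<phi> ` T} \<le> 2" using le[of i] by simp
  then show "gapped {a. (i, a) \<in> \<phi> ` T}"
    using gapped_if_card_le_2 C5_coordinates_row_subset[OF \<phi> T] by blast
qed

lemma ex_codominated_two_factors:
  assumes fin: "finite V" and \<phi>: "C5_coordinates V F \<phi>" and \<psi>: "C5_coordinates V G \<psi>"
  shows "\<exists>T\<subseteq>V. codominated V F T \<and> codominated V G T \<and> 5 * card T = 2 * card V"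
proof -
  obtain T where "T \<subseteq> V" "5 * card T = 2 * card V"
    "\<And>i. card {w \<in> T. fst (\<phi> w) = i} \<le> 2" "\<And>i. card {w \<in> T. fst (\<psi> w) = i} \<le> 2"
    using regular_bipartite_two_factor[OF fin, of 5 "\<lambda>w. fst (\<phi> w)" "\<lambda>w. fst (\<psi> w)"]
      C5_coordinates_fibre_card[OF \<phi>] C5_coordinates_fibre_card[OF \<psi>] by auto
  then show ?thesis
    using codominated_if_fibres_le_2[OF fin \<phi>] codominated_if_fibres_le_2[OF fin \<psi>] by blast
qed

text \<open>Induction over the factors beyond the first two, which account for the 2/5. Passing to a
  subset for a new factor costs a factor 3/5 and leaves the earlier factors satisfied.\<close>

lemma ex_codominated_k_factors:
  assumes fin: "finite V" and F: "\<forall>i\<in>{1..k + 2}. C5_factor V (F i)"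
  shows "\<exists>T\<subseteq>V. (\<forall>i\<in>{1..k + 2}. codominated V (F i) T) \<and>
    2/5 * (3/5) ^ k * real (card V) \<le> real (card T)"
  using F
proof (induction k)
  case 0
  have "C5_factor V (F 1)" "C5_factor V (F 2)" using 0 by auto
  then obtain \<phi> \<psi> where "C5_coordinates V (F 1) \<phi>" "C5_coordinates V (F 2) \<psi>"
    by (auto simp: C5_factor_iff_coordinates)
  then obtain T where T: "T \<subseteq> V" "codominated V (F 1) T" "codominated V (F 2) T"
    "5 * card T = 2 * card V"
    using ex_codominated_two_factors[OF fin, of "F 1" \<phi> "F 2" \<psi>] by auto
  have "{1..0 + 2} = {1, 2 :: nat}" by auto
  moreover have "5 * real (card T) = 2 * real (card V)"
    using arg_cong[OF T(4), of real] by simp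
  ultimately show ?case using T(1-3) by (intro exI[of _ T]) auto
next
  case (Suc k)
  then obtain T where T: "T \<subseteq> V" "\<forall>i\<in>{1..k + 2}. codominated V (F i) T"
    "2/5 * (3/5) ^ k * real (card V) \<le> real (card T)"
    by auto
  have "C5_factor V (F (k + 3))" using Suc.prems by simp
  then obtain \<phi> where "C5_coordinates V (F (k + 3)) \<phi>"
    by (auto simp: C5_factor_iff_coordinates)
  then obtain T' where T': "T' \<subseteq> T" "codominated V (F (k + 3)) T'" "3 * card T \<le> 5 * card T'"
    using ex_codominated_subset[OF fin _ T(1)] by blast
  have "{1..Suc k + 2} = insert (k + 3) {1..k + 2}" by auto
  then have "\<forall>i\<in>{1..Suc k + 2}. codominated V (F i) T'"
    using T(2) T'(2) codominated_subset[OF _ T'(1)] by auto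
  moreover have "3 * real (card T) \<le> 5 * real (card T')"
    using T'(3) by (metis of_nat_le_iff of_nat_mult of_nat_numeral)
  then have "2/5 * (3/5) ^ Suc k * real (card V) \<le> real (card T')"
    using T(3) by simp
  ultimately show ?case using T(1) T'(1) by blast
qed

section \<open>Bounds on the simultaneous domination number\<close>

lemma gamma_sd_le:
  assumes "finite V" "simultaneous_dominating_set V I F S"
  shows "gamma_sd V I F \<le> card S"
proof -
  have "finite {S. simultaneous_dominating_set V I F S}"
    using assms(1) by (auto simp: simultaneous_dominating_set_def intro: finite_subset[of _ "Pow V"])
  then show ?thesis using assms(2) by (auto simp: gamma_sd_def)
qed

lemma gamma_sd_attained:
  assumes "finite V"
  obtains S where "simultaneous_dominating_set V I F S" "card S = gamma_sd V I F"
proof -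
  have "finite {S. simultaneous_dominating_set V I F S}"
    using assms by (auto simp: simultaneous_dominating_set_def intro: finite_subset[of _ "Pow V"])
  moreover have "simultaneous_dominating_set V I F V"
    by (simp add: simultaneous_dominating_set_def)
  ultimately have "gamma_sd V I F \<in> card ` {S. simultaneous_dominating_set V I F S}"
    unfolding gamma_sd_def by (intro Min_in) auto
  then show ?thesis using that by auto
qed

lemma gamma_sd_C5_factors_le:
  assumes fin: "finite V" and F: "\<forall>i\<in>{1..k + 2}. C5_factor V (F i)"
  shows "real (gamma_sd V {1..k + 2} F) \<le> (3/5 + 2/5 * (1 - (3/5) ^ k)) * real (card V)"
proof -
  obtain T where T: "T \<subseteq> V" "\<forall>i\<in>{1..k + 2}. codominated V (F i) T"
    "2/5 * (3/5) ^ k * real (card V) \<le> real (card T)"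
    using ex_codominated_k_factors[OF assms] by blast
  have "gamma_sd V {1..k + 2} F \<le> card (V - T)"
    using fin T by (intro gamma_sd_le) (simp_all add: simultaneous_dominating_set_Diff)
  also have "real (card (V - T)) = real (card V) - real (card T)"
    using fin T(1) by (simp add: card_Diff_subset finite_subset of_nat_diff card_mono)
  \<comment> \<open>With \<open>q = (3/5) ^ k\<close>, the number \<open>1 - 2/5 * q\<close> equals
    \<open>3/5 + 2/5 * (1 - q)\<close>.\<close>
  finally show ?thesis using T(3) by (simp add: algebra_simps)
qed

text \<open>For \<open>k = 0\<close> the second summand of the general bound vanishes.\<close>

corollary gamma_sd_two_C5_factors_le:
  assumes "finite V" "\<forall>i\<in>{1, 2 :: nat}. C5_factor V (F i)"
  shows "real (gamma_sd V {1, 2} F) \<le> 3 * real (card V) / 5"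
proof -
  have "{1, 2} = {1..0 + 2 :: nat}" by auto
  then show ?thesis using gamma_sd_C5_factors_le[of V 0 F] assms by simp
qed

section \<open>Sharpness on five vertices\<close>

text \<open>Steps of length 2 in place of 1 make this the complement of
  \<open>cycle_graph 5\<close>.\<close>

definition pentagram_graph :: "nat pair_pre_digraph" where
  "pentagram_graph = \<lparr>pverts = {..<5},
     parcs = {(u, v). u < 5 \<and> v < 5 \<and> (v = (u + 2) mod 5 \<or> u = (v + 2) mod 5)}\<rparr>"

lemma C5_factor_cycle_graph: "C5_factor {..<5} (cycle_graph 5)"
proof -
  have "bij_betw (\<lambda>u. (0 :: nat, u)) {..<5 :: nat} ({..<1} \<times> {..<5})"
    by (auto simp: bij_betw_def inj_on_def)
  then have "C5_coordinates {..<5} (cycle_graph 5) (\<lambda>u. (0, u))"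
    by (simp add: C5_coordinates_def cycle_graph_def)
  then show ?thesis
    using pair_graph_cycle_graph[of 5] by (auto simp: C5_factor_iff_coordinates cycle_graph_def)
qed

lemma C5_factor_pentagram: "C5_factor {..<5} pentagram_graph"
proof -
  have "pair_graph pentagram_graph"
  proof
    show "finite (parcs pentagram_graph)"
      by (rule finite_subset[of _ "{..<5} \<times> {..<5}"]) (auto simp: pentagram_graph_def)
  qed (auto simp: pentagram_graph_def symmetric_def sym_def less_5_cases)
  \<comment> \<open>Multiplication by 3, the inverse of 2 modulo 5, turns steps of length 2 into
    steps of length 1; multiplication by 2 undoes it.\<close>
  moreover have "bij_betw (\<lambda>u. (0 :: nat, 3 * u mod 5)) {..<5 :: nat} ({..<1} \<times> {..<5})"
    by (rule bij_betw_byWitness[where f' = "\<lambda>x. 2 * snd x mod 5"]) (auto simp: less_5_cases)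
  then have "C5_coordinates {..<5} pentagram_graph (\<lambda>u. (0, 3 * u mod 5))"
    by (auto simp: C5_coordinates_def pentagram_graph_def less_5_cases) presburger+
  ultimately show ?thesis by (auto simp: C5_factor_iff_coordinates pentagram_graph_def)
qed

text \<open>Two distinct vertices are adjacent in exactly one of the two 5-cycles, and in it the
  vertex opposite that edge is adjacent to neither. The formal argument checks all pairs.\<close>

lemma card_simultaneous_dominating_cycle_pentagram:
  assumes S: "simultaneous_dominating_set {..<5} {1, 2 :: nat} ((\<lambda>_. pentagram_graph)(1 := cycle_graph 5)) S"
  shows "card S \<ge> 3"
proof (rule ccontr)
  assume "\<not> card S \<ge> 3"
  have "S \<subseteq> {..<5}" using S by (simp add: simultaneous_dominating_set_def)
  then have fin: "finite S" using finite_subset by blast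
  \<comment> \<open>Allowing \<open>a = b\<close> and a proper inclusion treats all sizes below 3 at
    once; enlarging a set preserves domination.\<close>
  have "\<exists>a<5. \<exists>b<5. S \<subseteq> {a, b}"
  proof -
    consider "card S = 0" | "card S = 1" | "card S = 2" using \<open>\<not> card S \<ge> 3\<close> by linarith
    then show ?thesis
    proof cases
      case 1
      then have "S \<subseteq> {0, 0}" using fin by simp
      then show ?thesis by (intro exI[of _ 0] conjI) simp_all
    next
      case 2
      then obtain a where "S = {a}" by (rule card_1_singletonE)
      then show ?thesis using \<open>S \<subseteq> {..<5}\<close> by auto
    next
      case 3
      then obtain a b where "S = {a, b}" by (auto simp: card_2_iff)
      then show ?thesis using \<open>S \<subseteq> {..<5}\<close> by auto
    qed
  qed
  then obtain a b where ab: "a < 5" "b < 5" "S \<subseteq> {a, b}" by blast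
  have 1: "v = a \<or> v = b \<or> v = Suc a mod 5 \<or> a = Suc v mod 5 \<or> v = Suc b mod 5 \<or> b = Suc v mod 5"
    and 2: "v = a \<or> v = b \<or> v = (a + 2) mod 5 \<or> a = (v + 2) mod 5 \<or> v = (b + 2) mod 5 \<or> b = (v + 2) mod 5"
    if "v < 5" for v
  proof -
    have "v \<in> S \<or> (\<exists>u\<in>S. (v, u) \<in> parcs (cycle_graph 5)) \<and>
        (\<exists>u\<in>S. (v, u) \<in> parcs pentagram_graph)"
      using S that by (simp add: simultaneous_dominating_set_def) blast
    then have "v \<in> {a, b} \<or> (\<exists>u\<in>{a, b}. (v, u) \<in> parcs (cycle_graph 5)) \<and>
        (\<exists>u\<in>{a, b}. (v, u) \<in> parcs pentagram_graph)"
      using ab(3) by blast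
    then show "v = a \<or> v = b \<or> v = Suc a mod 5 \<or> a = Suc v mod 5 \<or> v = Suc b mod 5 \<or> b = Suc v mod 5"
      "v = a \<or> v = b \<or> v = (a + 2) mod 5 \<or> a = (v + 2) mod 5 \<or> v = (b + 2) mod 5 \<or> b = (v + 2) mod 5"
      unfolding cycle_graph_def pentagram_graph_def by (simp_all, blast+)
  qed
  \<comment> \<open>In each of the 25 choices of \<open>a\<close> and \<open>b\<close>, some vertex
    violates one of the two domination conditions.\<close>
  show False
    using ab(1,2) unfolding less_5_cases
    by (elim disjE; use 1[of 0] 1[of 1] 1[of 2] 1[of 3] 1[of 4]
        2[of 0] 2[of 1] 2[of 2] 2[of 3] 2[of 4] in simp)
qed

theorem theorem26:
  shows "(\<forall>(n::nat) (k::nat) (V::'a set) (F::nat \<Rightarrow> 'a pair_pre_digraph).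
            n > 0 \<and> 5 dvd n \<and> k \<ge> 2 \<and> finite V \<and> card V = n \<and> (\<forall>i\<in>{1..k}. C5_factor V (F i)) \<longrightarrow>
              real (gamma_sd V {1, 2} F) \<le> 3 * real n / 5 \<and>
              (k \<ge> 3 \<longrightarrow>
                real (gamma_sd V {1..k} F) \<le> (3/5 + 2/5 * (1 - (3/5) ^ (k - 2))) * real n)) \<and>
         (\<exists>(n::nat) (V::nat set) (F::nat \<Rightarrow> nat pair_pre_digraph).
            n > 0 \<and> 5 dvd n \<and> finite V \<and> card V = n \<and> (\<forall>i\<in>{1, 2}. C5_factor V (F i)) \<and>
              real (gamma_sd V {1, 2} F) = 3 * real n / 5)"
proof (intro conjI allI impI; (elim conjE)?)
  fix n k :: nat and V :: "'a set" and F :: "nat \<Rightarrow> 'a pair_pre_digraph"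
  assume "2 \<le> k" "finite V" "card V = n" and F: "\<forall>i\<in>{1..k}. C5_factor V (F i)"
  then show "real (gamma_sd V {1, 2} F) \<le> 3 * real n / 5"
    using gamma_sd_two_C5_factors_le[of V F] by auto
  have "k - 2 + 2 = k" using \<open>2 \<le> k\<close> by simp
  then show "real (gamma_sd V {1..k} F) \<le> (3/5 + 2/5 * (1 - (3/5) ^ (k - 2))) * real n"
    using gamma_sd_C5_factors_le[of V "k - 2" F] \<open>finite V\<close> \<open>card V = n\<close> F by metis
next
  define F where "F = (\<lambda>_ :: nat. pentagram_graph)(1 := cycle_graph 5)"
  have F: "\<forall>i\<in>{1, 2}. C5_factor {..<5} (F i)"
    using C5_factor_cycle_graph C5_factor_pentagram by (simp add: F_def)
  obtain S where "simultaneous_dominating_set {..<5} {1, 2} F S" "card S = gamma_sd {..<5} {1, 2} F"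
    using gamma_sd_attained[of "{..<5 :: nat}"] by auto
  then have "gamma_sd {..<5} {1, 2} F \<ge> 3"
    using card_simultaneous_dominating_cycle_pentagram unfolding F_def by metis
  moreover have "real (gamma_sd {..<5} {1, 2} F) \<le> 3"
    using gamma_sd_two_C5_factors_le[OF _ F] by simp
  ultimately have "real (gamma_sd {..<5} {1, 2} F) = 3 * real 5 / 5" by simp
  with F show "\<exists>(n::nat) (V::nat set) (F::nat \<Rightarrow> nat pair_pre_digraph).
      n > 0 \<and> 5 dvd n \<and> finite V \<and> card V = n \<and> (\<forall>i\<in>{1, 2}. C5_factor V (F i)) \<and>
        real (gamma_sd V {1, 2} F) = 3 * real n / 5"
    by (intro exI[of _ 5] exI[of _ "{..<5}"] exI[of _ F]) simp
qed

end
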